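(* For any complete Boolean algebra $B$, the lattice $\mathbf{S_p}(B)$ of all algebraic subsets of $B$, ordered by inclusion, is subdirectly irreducible.
   Context: For a complete lattice $A$, a subset $X$ of $A$ is algebraic if $X$ is closed under arbitrary meets (including the empty meet, so that $1\in X$) and under joins of nonempty up-directed subsets, all computed in $A$. $\mathbf{S_p}(A)$ denotes the lattice of all algebraic subsets of $A$, ordered by inclusion. A lattice is subdirectly irreducible if it has only one element or it has a smallest lattice congruence among its non-identity congruences. *)

theory Defs
  imports "HOL-Algebra.Complete_Lattice"
begin

definition up_directed :: "'a::order set \<Rightarrow> bool" where
  "up_directed D \<longleftrightarrow> (\<forall>x\<in>D. \<forall>y\<in>D. \<exists>z\<in>D. x \<le> z \<and> y \<le> z)"

text \<open>The case \<open>S = {}\<close> of the first conjunct is \<open>top \<in> X\<close>.\<close>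

definition algebraic_subset :: "'a::complete_lattice set \<Rightarrow> bool" where
  "algebraic_subset X \<longleftrightarrow>
     (\<forall>S\<subseteq>X. Inf S \<in> X) \<and>
     (\<forall>D\<subseteq>X. D \<noteq> {} \<longrightarrow> up_directed D \<longrightarrow> Sup D \<in> X)"

text \<open>
  The lattice of algebraic subsets of the complete lattice given by the type \<open>'a\<close>. As an
  order structure it has no operations of its own: its meets and joins are those
  determined by inclusion among algebraic subsets. In particular, joins are not unions.

  For complete Boolean algebras take \<open>'a\<close> of sort \<open>{boolean_algebra, complete_lattice}\<close>. The
  class \<open>complete_boolean_algebra\<close> is too narrow, as it demands complete distributivity.
\<close>

definition Sp :: "'a::complete_lattice set gorder" where
  "Sp = \<lparr>carrier = {X. algebraic_subset X}, eq = (=), le = (\<subseteq>)\<rparr>"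

definition lattice_congruence :: "('a, 'b) gorder_scheme \<Rightarrow> ('a \<times> 'a) set \<Rightarrow> bool" where
  "lattice_congruence L \<theta> \<longleftrightarrow>
     equiv (carrier L) \<theta> \<and>
     (\<forall>x y u v. (x, y) \<in> \<theta> \<longrightarrow> (u, v) \<in> \<theta> \<longrightarrow>
        (x \<sqinter>\<^bsub>L\<^esub> u, y \<sqinter>\<^bsub>L\<^esub> v) \<in> \<theta> \<and> (x \<squnion>\<^bsub>L\<^esub> u, y \<squnion>\<^bsub>L\<^esub> v) \<in> \<theta>)"

text \<open>
  The conjunct \<open>lattice L\<close> ensures that \<open>.=\<close> is true equality, so that \<open>Id_on\<close> is the
  identity congruence.
\<close>

definition subdirectly_irreducible :: "('a, 'b) gorder_scheme \<Rightarrow> bool" where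
  "subdirectly_irreducible L \<longleftrightarrow>
     lattice L \<and>
     ((\<exists>x. carrier L = {x}) \<or>
      (\<exists>\<mu>. lattice_congruence L \<mu> \<and> \<mu> \<noteq> Id_on (carrier L) \<and>
         (\<forall>\<theta>. lattice_congruence L \<theta> \<longrightarrow> \<theta> \<noteq> Id_on (carrier L) \<longrightarrow> \<mu> \<subseteq> \<theta>)))"

lemma algebraic_subset_Inter:
  assumes "\<And>X. X \<in> \<X> \<Longrightarrow> algebraic_subset X"
  shows "algebraic_subset (\<Inter>\<X>)"
  unfolding algebraic_subset_def
proof (intro conjI allI impI)
  fix S assume "S \<subseteq> \<Inter>\<X>"
  then show "Inf S \<in> \<Inter>\<X>"
    using assms unfolding algebraic_subset_def by (meson Inter_iff Inter_lower subset_trans)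
next
  fix D assume "D \<subseteq> \<Inter>\<X>" "D \<noteq> {}" "up_directed D"
  then show "Sup D \<in> \<Inter>\<X>"
    using assms unfolding algebraic_subset_def by (meson Inter_iff Inter_lower subset_trans)
qed

lemma complete_lattice_Sp: "complete_lattice (Sp :: 'a::complete_lattice set gorder)"
proof -
  interpret partial_order "Sp :: 'a set gorder"
    by standard (auto simp: Sp_def)
  show ?thesis
  proof (rule complete_lattice_criterion1)
    have "greatest Sp UNIV (carrier (Sp :: 'a set gorder))"
      by (auto simp: greatest_def Sp_def algebraic_subset_def)
    then show "\<exists>g. greatest Sp g (carrier (Sp :: 'a set gorder))" ..
  next
    fix A :: "'a set set"
    assume A: "A \<subseteq> carrier Sp" "A \<noteq> {}"
    then have "algebraic_subset (\<Inter>A)"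
      by (intro algebraic_subset_Inter) (auto simp: Sp_def)
    then have "greatest Sp (\<Inter>A) (Lower Sp A)"
      using A by (auto simp: greatest_def Lower_def Sp_def)
    then show "\<exists>i. greatest Sp i (Lower Sp A)" ..
  qed
qed

end

theory Submission
  imports Defs
begin

hide_const (open) Order.top

text \<open>
  A nontrivial congruence identifies algebraic subsets \<open>X\<close>, \<open>Y\<close> with \<open>Y\<close> not inside \<open>X\<close>. Intersecting
  with \<open>{a, 1}\<close> for some \<open>a \<in> Y - X\<close>, it identifies \<open>{1}\<close> with \<open>{a, 1}\<close>. Joining with
  \<open>{-a, 1}\<close> puts \<open>a \<sqinter> -a = 0\<close> into the larger side only, and intersecting with \<open>{0, 1}\<close> then
  identifies \<open>{1}\<close> with \<open>{0, 1}\<close>. So every nontrivial congruence contains this one pair, and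
  the intersection of all of them is again nontrivial.
\<close>

text \<open>In a chain of at most two elements every nonempty subset contains its own infimum and
  supremum, and the empty infimum is \<open>top\<close>. These sets serve as the probes that a
  congruence is met and joined with.\<close>

lemma algebraic_subset_doubleton:
  fixes a :: "'a::complete_lattice"
  shows "algebraic_subset {a, top}"
proof -
  have "Inf S \<in> {a, top}" "S \<noteq> {} \<Longrightarrow> Sup S \<in> {a, top}" if "S \<subseteq> {a, top}" for S
  proof -
    from that have "S \<in> Pow {a, top}" by simp
    then have "S = {} \<or> S = {a} \<or> S = {top} \<or> S = {a, top}"
      by (auto simp: Pow_insert)
    then show "Inf S \<in> {a, top}" "S \<noteq> {} \<Longrightarrow> Sup S \<in> {a, top}"
      by auto
  qed
  then show ?thesis
    by (simp add: algebraic_subset_def)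
qed

lemma algebraic_subset_Inf: "algebraic_subset X \<Longrightarrow> S \<subseteq> X \<Longrightarrow> Inf S \<in> X"
  by (simp add: algebraic_subset_def)

lemma algebraic_subset_top: "algebraic_subset X \<Longrightarrow> top \<in> X"
  using algebraic_subset_Inf[of X "{}"] by simp

lemma algebraic_subset_inf:
  assumes "algebraic_subset X" "a \<in> X" "b \<in> X"
  shows "inf a b \<in> X"
  using algebraic_subset_Inf[of X "{a, b}"] assms by simp

lemma carrier_Sp [simp]: "X \<in> carrier Sp \<longleftrightarrow> algebraic_subset X"
  and le_Sp [simp]: "X \<sqsubseteq>\<^bsub>Sp\<^esub> Y \<longleftrightarrow> X \<subseteq> Y"
  by (simp_all add: Sp_def)

interpretation Sp: complete_lattice "Sp :: 'a::complete_lattice set gorder"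
  by (rule complete_lattice_Sp)

text \<open>Intersections of algebraic subsets are again algebraic. Joins have no such simple
  formula; further down they are handled only through their universal property.\<close>

lemma meet_Sp:
  fixes X Y :: "'a::complete_lattice set"
  assumes "algebraic_subset X" "algebraic_subset Y"
  shows "X \<sqinter>\<^bsub>Sp\<^esub> Y = X \<inter> Y"
proof
  show "X \<sqinter>\<^bsub>Sp\<^esub> Y \<subseteq> X \<inter> Y"
    using assms Sp.meet_left[of X Y] Sp.meet_right[of X Y] by simp
  have "algebraic_subset (X \<inter> Y)"
    using algebraic_subset_Inter[of "{X, Y}"] assms by auto
  then show "X \<inter> Y \<subseteq> X \<sqinter>\<^bsub>Sp\<^esub> Y"
    using assms Sp.meet_le[of "X \<inter> Y" X Y] by simp
qed

lemma lattice_congruence_Inter: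
  assumes "\<Theta> \<noteq> {}" and "\<And>\<theta>. \<theta> \<in> \<Theta> \<Longrightarrow> lattice_congruence L \<theta>"
  shows "lattice_congruence L (\<Inter>\<Theta>)"
proof -
  have "\<Inter>\<Theta> \<subseteq> carrier L \<times> carrier L" "refl_on (carrier L) (\<Inter>\<Theta>)" "sym (\<Inter>\<Theta>)" "trans (\<Inter>\<Theta>)"
    using assms unfolding lattice_congruence_def equiv_def refl_on_def sym_def trans_def
    by (blast, blast, blast, blast)
  then have "equiv (carrier L) (\<Inter>\<Theta>)"
    by (simp add: equiv_def)
  then show ?thesis
    using assms(2) unfolding lattice_congruence_def by blast
qed

lemma (in lattice) lattice_congruence_full: "lattice_congruence L (carrier L \<times> carrier L)"
proof -
  have "equiv (carrier L) (carrier L \<times> carrier L)"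
    by (intro equivI refl_onI symI transI) auto
  then show ?thesis
    unfolding lattice_congruence_def by simp
qed

text \<open>The intersection of all nontrivial congruences is the candidate for the smallest one; a
  pair of distinct elements lying in each of them keeps it from shrinking to the identity.\<close>

lemma subdirectly_irreducibleI:
  assumes "lattice L" and "x \<in> carrier L" "y \<in> carrier L" "x \<noteq> y"
    and critical: "\<And>\<theta>. lattice_congruence L \<theta> \<Longrightarrow> \<theta> \<noteq> Id_on (carrier L) \<Longrightarrow> (x, y) \<in> \<theta>"
  shows "subdirectly_irreducible L"
proof -
  define \<Theta> where "\<Theta> = {\<theta>. lattice_congruence L \<theta> \<and> \<theta> \<noteq> Id_on (carrier L)}"
  \<comment> \<open>The family must be nonempty, since an empty intersection would be
    \<open>UNIV\<close> and not a relation on the carrier. The full relation is nontrivial because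
    \<open>x\<close> and \<open>y\<close> differ.\<close>
  have "carrier L \<times> carrier L \<in> \<Theta>"
    using assms lattice.lattice_congruence_full[of L] by (auto simp: \<Theta>_def)
  then have "lattice_congruence L (\<Inter>\<Theta>)"
    by (intro lattice_congruence_Inter) (auto simp: \<Theta>_def)
  moreover have "(x, y) \<in> \<Inter>\<Theta>"
    using critical by (auto simp: \<Theta>_def)
  then have "\<Inter>\<Theta> \<noteq> Id_on (carrier L)"
    using \<open>x \<noteq> y\<close> by (metis Id_onE prod.inject)
  moreover have "\<forall>\<theta>. lattice_congruence L \<theta> \<longrightarrow> \<theta> \<noteq> Id_on (carrier L) \<longrightarrow> \<Inter>\<Theta> \<subseteq> \<theta>"
    by (auto simp: \<Theta>_def)
  ultimately show ?thesis
    using \<open>lattice L\<close> unfolding subdirectly_irreducible_def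
    by (intro conjI disjI2 exI[of _ "\<Inter>\<Theta>"])
qed

text \<open>For \<open>a\<close> other than \<open>top\<close>, \<open>{a, top}\<close> is an atom
  above the least element \<open>{top}\<close> of \<open>Sp\<close>, so meeting an algebraic subset
  with it tests membership of \<open>a\<close>.\<close>

lemma lattice_congruence_Sp_atom:
  fixes \<theta> :: "'a::complete_lattice set rel"
  assumes \<theta>: "lattice_congruence Sp \<theta>" and nontrivial: "\<theta> \<noteq> Id_on (carrier Sp)"
  obtains a where "a \<noteq> top" "({top}, {a, top}) \<in> \<theta>"
proof -
  have equiv: "equiv (carrier Sp) \<theta>"
    and meet: "\<And>X Y U V. (X, Y) \<in> \<theta> \<Longrightarrow> (U, V) \<in> \<theta> \<Longrightarrow> (X \<sqinter>\<^bsub>Sp\<^esub> U, Y \<sqinter>\<^bsub>Sp\<^esub> V) \<in> \<theta>"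
    using \<theta> by (auto simp: lattice_congruence_def)
  have refl: "(X, X) \<in> \<theta>" if "algebraic_subset X" for X
    using equiv that by (auto simp: equiv_def refl_on_def)
  have alg: "algebraic_subset X \<and> algebraic_subset Y" if "(X, Y) \<in> \<theta>" for X Y
    using equiv_type[OF equiv] that by auto
  have sym: "(Y, X) \<in> \<theta>" if "(X, Y) \<in> \<theta>" for X Y
    using equiv that by (auto simp: equiv_def sym_def)
  have "\<exists>X Y. (X, Y) \<in> \<theta> \<and> X \<noteq> Y"
  proof (rule ccontr)
    assume "\<not> ?thesis"
    then have "\<theta> = Id_on (carrier Sp)"
      using alg refl by (force simp: Id_on_def)
    then show False using nontrivial by contradiction
  qed
  \<comment> \<open>Two distinct sets fail to include each other in at least one direction; symmetry
    of \<open>\<theta>\<close> lets the pair be ordered accordingly.\<close>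
  then obtain X Y where "(X, Y) \<in> \<theta>" "\<not> Y \<subseteq> X"
    using sym by blast
  then obtain a where a: "a \<in> Y" "a \<notin> X" by blast
  have XY: "algebraic_subset X" "algebraic_subset Y"
    using alg \<open>(X, Y) \<in> \<theta>\<close> by auto
  have "X \<sqinter>\<^bsub>Sp\<^esub> {a, top} = {top}" "Y \<sqinter>\<^bsub>Sp\<^esub> {a, top} = {a, top}"
    using a XY algebraic_subset_top by (auto simp: meet_Sp algebraic_subset_doubleton)
  then have "({top}, {a, top}) \<in> \<theta>"
    using meet[OF \<open>(X, Y) \<in> \<theta>\<close> refl[OF algebraic_subset_doubleton[of a]]] by simp
  moreover have "a \<noteq> top"
    using a XY algebraic_subset_top by blast
  ultimately show ?thesis using that by blast
qed

lemma lattice_congruence_Sp_bot: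
  fixes \<theta> :: "'a::{boolean_algebra, complete_lattice} set rel"
  assumes \<theta>: "lattice_congruence Sp \<theta>" and nontrivial: "\<theta> \<noteq> Id_on (carrier Sp)"
  shows "({top}, {bot, top}) \<in> \<theta>"
proof -
  have refl: "({x, top}, {x, top}) \<in> \<theta>" for x
    using \<theta> by (auto simp: lattice_congruence_def equiv_def refl_on_def algebraic_subset_doubleton)
  obtain a where a: "a \<noteq> top" "({top}, {a, top}) \<in> \<theta>"
    using lattice_congruence_Sp_atom[OF \<theta> nontrivial] by blast
  define J where "J = {a, top} \<squnion>\<^bsub>Sp\<^esub> {- a, top}"
  have alg_top: "algebraic_subset {top::'a}"
    using algebraic_subset_doubleton[of "top::'a"] by simp
  \<comment> \<open>\<open>{top}\<close> is the least element of \<open>Sp\<close>, so joining with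
    it changes nothing.\<close>
  have "{top} \<squnion>\<^bsub>Sp\<^esub> {- a, top} = {- a, top}"
    using Sp.join_le[of "{top}" "{- a, top}" "{- a, top}"] Sp.join_right[of "{top}" "{- a, top}"]
    by (intro subset_antisym) (simp_all add: alg_top algebraic_subset_doubleton)
  moreover have "({top} \<squnion>\<^bsub>Sp\<^esub> {- a, top}, J) \<in> \<theta>"
    unfolding J_def using \<theta> a refl by (simp add: lattice_congruence_def)
  ultimately have "({- a, top} \<sqinter>\<^bsub>Sp\<^esub> {bot, top}, J \<sqinter>\<^bsub>Sp\<^esub> {bot, top}) \<in> \<theta>"
    using \<theta> refl by (simp add: lattice_congruence_def)
  \<comment> \<open>This keeps \<open>bot\<close> out of the smaller side: \<open>{- a, top}\<close>
    contains \<open>bot\<close> only if \<open>- a = bot\<close> or the algebra is trivial, and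
    either would force \<open>a = top\<close>.\<close>
  moreover have "- a \<noteq> bot"
    using a(1) by (metis double_compl compl_bot_eq)
  then have "{- a, top} \<sqinter>\<^bsub>Sp\<^esub> {bot, top} = {top}"
    by (auto simp: meet_Sp algebraic_subset_doubleton)
  moreover have J: "algebraic_subset J"
    using Sp.join_closed[of "{a, top}" "{- a, top}"]
    by (simp add: J_def algebraic_subset_doubleton)
  have "a \<in> J" "- a \<in> J"
    using Sp.join_left[of "{a, top}" "{- a, top}"] Sp.join_right[of "{a, top}" "{- a, top}"]
    by (simp_all add: J_def algebraic_subset_doubleton)
  \<comment> \<open>The elements of \<open>J\<close> need not be determined: closure under binary
    meets already yields \<open>inf a (- a) = bot\<close>.\<close>
  then have "bot \<in> J"
    using algebraic_subset_inf[OF J, of a "- a"] by simp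
  then have "J \<sqinter>\<^bsub>Sp\<^esub> {bot, top} = {bot, top}"
    using J algebraic_subset_top[OF J] by (auto simp: meet_Sp algebraic_subset_doubleton)
  ultimately show ?thesis by simp
qed

theorem proposition4p2:
  shows "subdirectly_irreducible (Sp :: 'b::{boolean_algebra, complete_lattice} set gorder)"
proof (cases "(bot::'b) = top")
  \<comment> \<open>In the one-element algebra the critical pair \<open>{top}\<close>,
    \<open>{bot, top}\<close> degenerates, and \<open>Sp\<close> has a single element.\<close>
  case True
  then have "x = top" for x :: 'b
    by (metis bot_least top_unique)
  then have "X = {top}" if "algebraic_subset X" for X :: "'b set"
    using algebraic_subset_top[OF that] by blast
  moreover have "algebraic_subset {top::'b}"
    using algebraic_subset_doubleton[of "top::'b"] by simp
  ultimately have "carrier (Sp :: 'b set gorder) = {{top}}"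
    unfolding set_eq_iff[of "carrier Sp"] carrier_Sp singleton_iff by blast
  then show ?thesis
    using Sp.lattice_axioms unfolding subdirectly_irreducible_def by blast
next
  case False
  show ?thesis
  proof (rule subdirectly_irreducibleI)
    show "{top::'b} \<in> carrier Sp" "{bot::'b, top} \<in> carrier Sp"
      using algebraic_subset_doubleton[of "top::'b"] by (simp_all add: algebraic_subset_doubleton)
    show "{top::'b} \<noteq> {bot, top}"
      using False by blast
  qed (simp_all add: Sp.lattice_axioms lattice_congruence_Sp_bot)
qed

end
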